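(* Let $\bar u\in H$ with $g(\bar u)\in K$ be a solution of the general equilibrium problem $$F(\bar u,g(v))\ge 0\qquad\text{for all } v\in H\text{ with } g(v)\in K .$$ Let $\rho>0$ and $\beta>0$ be constants and let $u_{n+1}$ be the approximate solution obtained from $u_n$ by the predictor-corrector scheme: $w_n,u_{n+1}\in H$ with $g(w_n),g(u_{n+1})\in K$ satisfy, for all $v\in H$ with $g(v)\in K$, $$\beta F(u_n,g(v))+\langle g(w_n)-g(u_n),\,g(v)-g(w_n)\rangle\ge 0,$$ $$\rho F(w_n,g(v))+\langle g(u_{n+1})-g(w_n),\,g(v)-g(u_{n+1})\rangle\ge 0 .$$ If the bifunction $F(\cdot,\cdot)$ is $g$-partially relaxed strongly monotone with constant $\alpha>0$, then $$\|g(\bar u)-g(u_{n+1})\|^2\le\|g(\bar u)-g(w_n)\|^2-(1-2\alpha\rho)\,\|g(w_n)-g(u_{n+1})\|^2,$$ $$\|g(\bar u)-g(w_n)\|^2\le\|g(\bar u)-g(u_n)\|^2-(1-2\alpha\beta)\,\|g(w_n)-g(u_n)\|^2 .$$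
   Context: $H$ is a real Hilbert space with inner product $\langle\cdot,\cdot\rangle$ and norm $\|\cdot\|$; $K\subseteq H$ is a nonempty closed convex set; $g:H\to H$ is an operator (onto $K$, as a standing assumption), and $F:H\times H\to\mathbb{R}$ is a nonlinear bifunction. $F$ is called $g$-partially relaxed strongly monotone with constant $\alpha>0$ if $$F(u,g(v))+F(v,g(z))\le\alpha\,\|g(z)-g(u)\|^2\qquad\text{for all } u,v,z\in H .$$ *)

theory Defs
  imports "HOL-Analysis.Analysis"
begin

definition partially_relaxed_strongly_monotone ::
    "('a::real_inner \<Rightarrow> 'a) \<Rightarrow> ('a \<Rightarrow> 'a \<Rightarrow> real) \<Rightarrow> real \<Rightarrow> bool" where
  "partially_relaxed_strongly_monotone g F \<alpha> \<longleftrightarrow>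
     \<alpha> > 0 \<and> (\<forall>u v z. F u (g v) + F v (g z) \<le> \<alpha> * (norm (g z - g u))\<^sup>2)"

definition general_equilibrium_solution ::
    "'a::real_inner set \<Rightarrow> ('a \<Rightarrow> 'a) \<Rightarrow> ('a \<Rightarrow> 'a \<Rightarrow> real) \<Rightarrow> 'a \<Rightarrow> bool" where
  "general_equilibrium_solution K g F x \<longleftrightarrow>
     g x \<in> K \<and> (\<forall>v. g v \<in> K \<longrightarrow> F x (g v) \<ge> 0)"

text \<open>One auxiliary equilibrium step with parameter \<open>\<rho>\<close>, from the current point \<open>x\<close> to a
  new point \<open>y\<close>. It is a relation, since \<open>y\<close> need be neither existent nor unique;
  only \<open>g y\<close>, not \<open>g x\<close>, is required to lie in \<open>K\<close>.\<close>

definition auxiliary_step ::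
    "'a::real_inner set \<Rightarrow> ('a \<Rightarrow> 'a) \<Rightarrow> ('a \<Rightarrow> 'a \<Rightarrow> real) \<Rightarrow> real \<Rightarrow> 'a \<Rightarrow> 'a \<Rightarrow> bool" where
  "auxiliary_step K g F \<rho> x y \<longleftrightarrow>
     g y \<in> K \<and> (\<forall>v. g v \<in> K \<longrightarrow> \<rho> * F x (g v) + (g y - g x) \<bullet> (g v - g y) \<ge> 0)"

definition predictor_corrector_step ::
    "'a::real_inner set \<Rightarrow> ('a \<Rightarrow> 'a) \<Rightarrow> ('a \<Rightarrow> 'a \<Rightarrow> real) \<Rightarrow> real \<Rightarrow> real \<Rightarrow> 'a \<Rightarrow> 'a \<Rightarrow> 'a \<Rightarrow> bool" where
  "predictor_corrector_step K g F \<beta> \<rho> x w y \<longleftrightarrow>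
     auxiliary_step K g F \<beta> x w \<and> auxiliary_step K g F \<rho> w y"

end

theory Submission
  imports Defs
begin

text \<open>
  Both estimates are instances of one inequality for a single auxiliary step from \<open>x\<close> to \<open>y\<close>:
  the corrector is such a step from \<open>w n\<close> with parameter \<open>\<rho>\<close>, the predictor one from \<open>u n\<close>
  with parameter \<open>\<beta>\<close>.

  For a single step, expanding the square gives
  \<open>\<parallel>g ubar - g x\<parallel>\<^sup>2 = \<parallel>g ubar - g y\<parallel>\<^sup>2 + \<parallel>g y - g x\<parallel>\<^sup>2 + 2 \<langle>g y - g x, g ubar - g y\<rangle>\<close>,
  so a lower bound for the inner product is all that matters. Testing the step with the
  solution \<open>ubar\<close> bounds it below by \<open>- \<rho> F(x, g ubar)\<close>. The solution, tested with \<open>y\<close>, gives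
  \<open>F(ubar, g y) \<ge> 0\<close>, and partial relaxed strong monotonicity along the triple
  \<open>x, ubar, y\<close> then bounds \<open>F(x, g ubar)\<close> above by \<open>\<alpha> \<parallel>g y - g x\<parallel>\<^sup>2\<close>.
\<close>

lemma auxiliary_step_descent:
  fixes g :: "'a::real_inner \<Rightarrow> 'a"
  assumes mono: "partially_relaxed_strongly_monotone g F \<alpha>"
    and sol: "general_equilibrium_solution K g F ubar"
    and step: "auxiliary_step K g F \<rho> x y"
    and "\<rho> \<ge> 0"
  shows "(norm (g ubar - g y))\<^sup>2
           \<le> (norm (g ubar - g x))\<^sup>2 - (1 - 2 * \<alpha> * \<rho>) * (norm (g y - g x))\<^sup>2"
proof -
  have tested_step: "\<rho> * F x (g ubar) + (g y - g x) \<bullet> (g ubar - g y) \<ge> 0"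
    using sol step unfolding general_equilibrium_solution_def auxiliary_step_def by blast
  have "F ubar (g y) \<ge> 0"
    using sol step unfolding general_equilibrium_solution_def auxiliary_step_def by blast
  moreover have "F x (g ubar) + F ubar (g y) \<le> \<alpha> * (norm (g y - g x))\<^sup>2"
    using mono unfolding partially_relaxed_strongly_monotone_def by blast
  ultimately have "F x (g ubar) \<le> \<alpha> * (norm (g y - g x))\<^sup>2"
    by linarith
  then have "\<rho> * F x (g ubar) \<le> \<rho> * (\<alpha> * (norm (g y - g x))\<^sup>2)"
    using \<open>\<rho> \<ge> 0\<close> by (rule mult_left_mono)
  with tested_step
  have "(g y - g x) \<bullet> (g ubar - g y) \<ge> - (\<alpha> * \<rho> * (norm (g y - g x))\<^sup>2)"
    by (simp add: ac_simps)
  moreover have "(norm (g ubar - g x))\<^sup>2 =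
      (norm (g ubar - g y))\<^sup>2 + (norm (g y - g x))\<^sup>2 + 2 * ((g y - g x) \<bullet> (g ubar - g y))"
    by (simp add: power2_norm_eq_inner inner_diff_left inner_diff_right inner_commute)
  ultimately show ?thesis
    by (simp add: algebra_simps)
qed

theorem theorem8:
  fixes K :: "'a::{real_inner,complete_space} set"
    and g :: "'a \<Rightarrow> 'a"
    and F :: "'a \<Rightarrow> 'a \<Rightarrow> real"
    and ubar :: 'a
    and u w :: "nat \<Rightarrow> 'a"
    and n :: nat
    and \<alpha> \<beta> \<rho> :: real
  assumes "K \<noteq> {}" and "closed K" and "convex K"
    and "K \<subseteq> range g"
    and "general_equilibrium_solution K g F ubar"
    and "\<rho> > 0" and "\<beta> > 0"
    and "predictor_corrector_step K g F \<beta> \<rho> (u n) (w n) (u (Suc n))"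
    and "partially_relaxed_strongly_monotone g F \<alpha>"
  shows "(norm (g ubar - g (u (Suc n))))\<^sup>2
           \<le> (norm (g ubar - g (w n)))\<^sup>2
             - (1 - 2 * \<alpha> * \<rho>) * (norm (g (w n) - g (u (Suc n))))\<^sup>2
       \<and> (norm (g ubar - g (w n)))\<^sup>2
           \<le> (norm (g ubar - g (u n)))\<^sup>2
             - (1 - 2 * \<alpha> * \<beta>) * (norm (g (w n) - g (u n)))\<^sup>2"
proof -
  have predictor: "auxiliary_step K g F \<beta> (u n) (w n)"
    and corrector: "auxiliary_step K g F \<rho> (w n) (u (Suc n))"
    using assms(8) unfolding predictor_corrector_step_def by blast+
  show ?thesis
    using auxiliary_step_descent[OF assms(9,5) corrector]
      auxiliary_step_descent[OF assms(9,5) predictor] \<open>\<rho> > 0\<close> \<open>\<beta> > 0\<close>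
    by (simp add: norm_minus_commute[of "g (w n)" "g (u (Suc n))"])
qed

end
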